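(* Let $V$ be a finite set, $R=\mathbb C^q$ with primitive idempotents $\varepsilon_1,\dots,\varepsilon_q$, and let $w_{ij}=w_{ji}=\sum_{\alpha}w_{ij}^{(\alpha)}\varepsilon_\alpha\in\mathbb C^q$ be symmetric weights with $w_{ii}=0$. The bracket $[f,g]_i=\sum_j w_{ij}(f_ig_j-f_jg_i)$ on $\mathfrak g=R^V$ together with the canonical cobracket $\delta(e_i)=\sum_j w_{ij}\,e_i\wedge e_j$ is a Lie bialgebra over $R$ if and only if, for every $\alpha\in\{1,\dots,q\}$, the scalar channel support $$G_\alpha=\bigl(V,\{ij:\ w_{ij}^{(\alpha)}\neq0\}\bigr)$$ is a matching (every vertex is incident to at most one edge of $G_\alpha$).
   Context: $\{e_i\}_{i\in V}$ is the coordinate basis of $R^V$; $\delta:\mathfrak g\to\bigwedge^2_R\mathfrak g$ is extended $R$-linearly. "Lie bialgebra over $R$" is in the finite free module sense: the bracket is $R$-bilinear, antisymmetric and satisfies the Jacobi identity; $\delta$ satisfies co-Jacobi, i.e. the induced bracket on $\mathfrak g^*$, $\langle[\xi,\eta]^*,x\rangle=\langle\xi\wedge\eta,\delta(x)\rangle$ with $\langle\xi\wedge\eta,u\wedge v\rangle=\xi(u)\eta(v)-\xi(v)\eta(u)$, satisfies the Jacobi identity; and $\delta([x,y])=\operatorname{ad}^{(2)}_x\delta(y)-\operatorname{ad}^{(2)}_y\delta(x)$ for all $x,y\in\mathfrak g$, where $\operatorname{ad}^{(2)}_x(u\wedge v)=[x,u]\wedge v+u\wedge[x,v]$. *)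

theory Defs
  imports "HOL-Analysis.Analysis"
begin

section \<open>The free module \<open>R^V\<close> and its exterior square\<close>

text \<open>
  For a commutative ring \<open>'r\<close> and a finite type \<open>'v\<close>, the free module on \<open>'v\<close> is
  \<open>'r ^ 'v\<close>, with scalar multiplication \<open>*s\<close> and coordinate basis \<open>axis i 1\<close>.
  Its tensor square is identified with \<open>'r ^ ('v \<times> 'v)\<close>; the exterior square is identified
  with the submodule of alternating tensors, the class of \<open>u \<and> v\<close> being
  \<open>u \<otimes> v - v \<otimes> u\<close>. For a finite free module this is an isomorphism over every
  commutative ring, since it maps the basis \<open>e\<^sub>i \<and> e\<^sub>j\<close> \<open>(i < j)\<close> to a basis.
\<close>

definition tensor :: "'r::comm_ring_1 ^ 'v::finite \<Rightarrow> 'r ^ 'v \<Rightarrow> 'r ^ ('v \<times> 'v)" where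
  "tensor u v = (\<chi> p. u $ fst p * v $ snd p)"

definition wedge :: "'r::comm_ring_1 ^ 'v::finite \<Rightarrow> 'r ^ 'v \<Rightarrow> 'r ^ ('v \<times> 'v)" where
  "wedge u v = tensor u v - tensor v u"

definition exterior_square :: "('r::comm_ring_1 ^ ('v::finite \<times> 'v)) set" where
  "exterior_square = {M. (\<forall>i. M $ (i, i) = 0) \<and> (\<forall>i j. M $ (i, j) = - M $ (j, i))}"

text \<open>
  \<open>\<langle>\<xi> \<and> \<eta>, M\<rangle>\<close>, obtained from \<open>M = (\<Sum>i j. M\<^sub>i\<^sub>j e\<^sub>i \<otimes> e\<^sub>j)\<close>;
  on a decomposable element it is \<open>\<xi>(u) \<eta>(v) - \<xi>(v) \<eta>(u)\<close>, see
  \<open>wedge_pairing_wedge\<close> below.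
\<close>

definition wedge_pairing ::
  "('r::comm_ring_1 ^ 'v::finite \<Rightarrow> 'r) \<Rightarrow> ('r ^ 'v \<Rightarrow> 'r) \<Rightarrow> 'r ^ ('v \<times> 'v) \<Rightarrow> 'r" where
  "wedge_pairing \<xi> \<eta> M =
     (\<Sum>i\<in>UNIV. \<Sum>j\<in>UNIV. M $ (i, j) * (\<xi> (axis i 1) * \<eta> (axis j 1)))"

text \<open>
  The action of \<open>ad\<^sub>x \<otimes> 1 + 1 \<otimes> ad\<^sub>x\<close>; on a decomposable element it is
  \<open>[x,u] \<and> v + u \<and> [x,v]\<close>, see \<open>ad2_wedge\<close> below.
\<close>

definition ad2 ::
  "('r::comm_ring_1 ^ 'v::finite \<Rightarrow> 'r ^ 'v \<Rightarrow> 'r ^ 'v) \<Rightarrow> 'r ^ 'v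
     \<Rightarrow> 'r ^ ('v \<times> 'v) \<Rightarrow> 'r ^ ('v \<times> 'v)" where
  "ad2 br x M = (\<Sum>i\<in>UNIV. \<Sum>j\<in>UNIV. M $ (i, j) *s
     (tensor (br x (axis i 1)) (axis j 1) + tensor (axis i 1) (br x (axis j 1))))"


section \<open>Lie bialgebras\<close>

definition lie_bracket :: "('r::comm_ring_1 ^ 'v::finite \<Rightarrow> 'r ^ 'v \<Rightarrow> 'r ^ 'v) \<Rightarrow> bool" where
  "lie_bracket br \<longleftrightarrow>
     (\<forall>x. module_hom (*s) (*s) (br x)) \<and>
     (\<forall>y. module_hom (*s) (*s) (\<lambda>x. br x y)) \<and>
     (\<forall>x y. br x y = - br y x) \<and>
     (\<forall>x y z. br x (br y z) + br y (br z x) + br z (br x y) = 0)"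

definition dual_bracket ::
  "('r::comm_ring_1 ^ 'v::finite \<Rightarrow> 'r ^ ('v \<times> 'v))
     \<Rightarrow> ('r ^ 'v \<Rightarrow> 'r) \<Rightarrow> ('r ^ 'v \<Rightarrow> 'r) \<Rightarrow> 'r ^ 'v \<Rightarrow> 'r" where
  "dual_bracket \<delta> \<xi> \<eta> = (\<lambda>x. wedge_pairing \<xi> \<eta> (\<delta> x))"

definition lie_cobracket :: "('r::comm_ring_1 ^ 'v::finite \<Rightarrow> 'r ^ ('v \<times> 'v)) \<Rightarrow> bool" where
  "lie_cobracket \<delta> \<longleftrightarrow>
     module_hom (*s) (*s) \<delta> \<and>
     range \<delta> \<subseteq> exterior_square \<and>
     (\<forall>\<xi> \<eta> \<zeta>. module_hom (*s) (*) \<xi> \<longrightarrow> module_hom (*s) (*) \<eta> \<longrightarrow> module_hom (*s) (*) \<zeta> \<longrightarrow>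
        (\<forall>x. dual_bracket \<delta> \<xi> (dual_bracket \<delta> \<eta> \<zeta>) x
           + dual_bracket \<delta> \<eta> (dual_bracket \<delta> \<zeta> \<xi>) x
           + dual_bracket \<delta> \<zeta> (dual_bracket \<delta> \<xi> \<eta>) x = 0))"

definition lie_bialgebra ::
  "('r::comm_ring_1 ^ 'v::finite \<Rightarrow> 'r ^ 'v \<Rightarrow> 'r ^ 'v) \<Rightarrow> ('r ^ 'v \<Rightarrow> 'r ^ ('v \<times> 'v)) \<Rightarrow> bool" where
  "lie_bialgebra br \<delta> \<longleftrightarrow>
     lie_bracket br \<and> lie_cobracket \<delta> \<and>
     (\<forall>x y. \<delta> (br x y) = ad2 br x (\<delta> y) - ad2 br y (\<delta> x))"


section \<open>The bracket and cobracket of a weighted graph\<close>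

definition weight_bracket ::
  "('v::finite \<Rightarrow> 'v \<Rightarrow> 'r::comm_ring_1) \<Rightarrow> 'r ^ 'v \<Rightarrow> 'r ^ 'v \<Rightarrow> 'r ^ 'v" where
  "weight_bracket w f g = (\<chi> i. \<Sum>j\<in>UNIV. w i j * (f $ i * g $ j - f $ j * g $ i))"

definition weight_cobracket ::
  "('v::finite \<Rightarrow> 'v \<Rightarrow> 'r::comm_ring_1) \<Rightarrow> 'r ^ 'v \<Rightarrow> 'r ^ ('v \<times> 'v)" where
  "weight_cobracket w f =
     (\<Sum>i\<in>UNIV. f $ i *s (\<Sum>j\<in>UNIV. w i j *s wedge (axis i 1) (axis j 1)))"

text \<open>
  The ring \<open>\<complex>\<^sup>q\<close> is \<open>complex ^ 'q\<close> with its componentwise multiplication. Its primitive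
  idempotents are \<open>axis \<alpha> 1\<close>, so the coefficient of a weight at the idempotent \<open>\<alpha>\<close> is its
  component \<open>w i j $ \<alpha>\<close>.
\<close>

definition channel_support :: "('v \<Rightarrow> 'v \<Rightarrow> complex ^ 'q::finite) \<Rightarrow> 'q \<Rightarrow> 'v set set" where
  "channel_support w \<alpha> = {{i, j} | i j. w i j $ \<alpha> \<noteq> 0}"

definition is_matching :: "'v set set \<Rightarrow> bool" where
  "is_matching E \<longleftrightarrow> (\<forall>v. \<exists>\<^sub>\<le>\<^sub>1 e. e \<in> E \<and> v \<in> e)"


section \<open>Checks of the encodings\<close>

lemma module_vec: "module ((*s) :: 'r::comm_ring_1 \<Rightarrow> 'r ^ 'n \<Rightarrow> 'r ^ 'n)"
  by unfold_locales (simp_all add: vec_eq_iff algebra_simps)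

lemma tensor_component [simp]: "tensor u v $ (i, j) = u $ i * v $ j"
  by (simp add: tensor_def)

lemma wedge_component [simp]: "wedge u v $ (i, j) = u $ i * v $ j - v $ i * u $ j"
  by (simp add: wedge_def)

lemma wedge_in_exterior_square: "wedge u v \<in> exterior_square"
  by (simp add: exterior_square_def)

lemma axis_prod_eq: "tensor (axis i 1) (axis j 1) = axis (i, j) 1"
  by (auto simp: vec_eq_iff axis_def)

lemma tensor_expansion:
  fixes M :: "'r::comm_ring_1 ^ ('v::finite \<times> 'v)"
  shows "M = (\<Sum>i\<in>UNIV. \<Sum>j\<in>UNIV. M $ (i, j) *s tensor (axis i 1) (axis j 1))"
proof -
  have "(\<Sum>i\<in>UNIV. \<Sum>j\<in>UNIV. M $ (i, j) *s tensor (axis i 1) (axis j 1))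
      = (\<Sum>p\<in>UNIV. M $ p *s axis p 1)"
    unfolding axis_prod_eq sum.cartesian_product by (simp add: case_prod_beta)
  then show ?thesis by (simp only: basis_expansion)
qed

lemma exterior_square_expansion:
  fixes M :: "'r::comm_ring_1 ^ ('v::finite \<times> 'v)"
  assumes "M \<in> exterior_square"
  shows "M + M = (\<Sum>i\<in>UNIV. \<Sum>j\<in>UNIV. M $ (i, j) *s wedge (axis i 1) (axis j 1))"
proof -
  interpret module "(*s) :: 'r \<Rightarrow> 'r ^ ('v \<times> 'v) \<Rightarrow> _" by (rule module_vec)
  have alt: "M $ (i, j) = - M $ (j, i)" for i j
    using assms unfolding exterior_square_def by blast
  have "(\<Sum>i\<in>UNIV. \<Sum>j\<in>UNIV. M $ (i, j) *s tensor (axis j 1) (axis i 1))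
      = (\<Sum>i\<in>UNIV. \<Sum>j\<in>UNIV. (- M $ (j, i)) *s tensor (axis j 1) (axis i 1))"
    by (intro sum.cong refl, subst alt) (rule refl)
  also have "\<dots> = - (\<Sum>i\<in>UNIV. \<Sum>j\<in>UNIV. M $ (j, i) *s tensor (axis j 1) (axis i 1))"
    by (simp only: scale_minus_left sum_negf)
  also have "\<dots> = - M"
    by (subst sum.swap) (simp only: tensor_expansion[symmetric])
  finally show ?thesis
    by (simp only: wedge_def scale_right_diff_distrib sum_subtractf tensor_expansion[symmetric])
       simp
qed

lemma linear_expansion:
  fixes \<xi> :: "'r::comm_ring_1 ^ 'v::finite \<Rightarrow> 'r"
  assumes "module_hom (*s) (*) \<xi>"
  shows "\<xi> u = (\<Sum>i\<in>UNIV. u $ i * \<xi> (axis i 1))"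
proof -
  interpret module_hom "(*s)" "(*)" \<xi> by fact
  have "\<xi> u = \<xi> (\<Sum>i\<in>UNIV. u $ i *s axis i 1)" by (simp only: basis_expansion)
  also have "\<dots> = (\<Sum>i\<in>UNIV. u $ i * \<xi> (axis i 1))" by (simp only: sum scale)
  finally show ?thesis .
qed

lemma linear_vec_expansion:
  fixes f :: "'r::comm_ring_1 ^ 'v::finite \<Rightarrow> 'r ^ 'w::finite"
  assumes "module_hom (*s) (*s) f"
  shows "f u = (\<Sum>i\<in>UNIV. u $ i *s f (axis i 1))"
proof -
  interpret module_hom "(*s)" "(*s)" f by fact
  have "f u = f (\<Sum>i\<in>UNIV. u $ i *s axis i 1)" by (simp only: basis_expansion)
  also have "\<dots> = (\<Sum>i\<in>UNIV. u $ i *s f (axis i 1))" by (simp only: sum scale)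
  finally show ?thesis .
qed

lemma wedge_pairing_wedge:
  assumes "module_hom (*s) (*) \<xi>" "module_hom (*s) (*) \<eta>"
  shows "wedge_pairing \<xi> \<eta> (wedge u v) = \<xi> u * \<eta> v - \<xi> v * \<eta> u"
  unfolding wedge_pairing_def
    linear_expansion[OF assms(1), of u] linear_expansion[OF assms(1), of v]
    linear_expansion[OF assms(2), of u] linear_expansion[OF assms(2), of v]
    sum_product sum_subtractf[symmetric]
  by (intro sum.cong refl) (simp add: algebra_simps)

lemma ad2_wedge:
  assumes "module_hom (*s) (*s) (br x)"
  shows "ad2 br x (wedge u v) = wedge (br x u) v + wedge u (br x v)"
proof -
  have ax: "(\<Sum>i\<in>UNIV. c i * axis i (1::'a) $ k) = c k" for c :: "'b \<Rightarrow> 'a" and k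
    by (simp add: axis_def if_distrib cong: if_cong)
  have br: "br x u $ k = (\<Sum>i\<in>UNIV. u $ i * br x (axis i 1) $ k)" for u k
    by (subst linear_vec_expansion[OF assms]) simp
  have "ad2 br x (wedge u v) $ (k, l) = (wedge (br x u) v + wedge u (br x v)) $ (k, l)" for k l
  proof -
    have "ad2 br x (wedge u v) $ (k, l)
        = (\<Sum>i\<in>UNIV. \<Sum>j\<in>UNIV. ((u $ i * v $ j - v $ i * u $ j) * br x (axis i 1) $ k) * axis j 1 $ l)
        + (\<Sum>j\<in>UNIV. \<Sum>i\<in>UNIV. ((u $ i * v $ j - v $ i * u $ j) * br x (axis j 1) $ l) * axis i 1 $ k)"
      unfolding ad2_def
      by (subst (3) sum.swap) (simp add: sum.distrib[symmetric] algebra_simps)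
    also have "\<dots> = (\<Sum>i\<in>UNIV. (u $ i * v $ l - v $ i * u $ l) * br x (axis i 1) $ k)
        + (\<Sum>j\<in>UNIV. (u $ k * v $ j - v $ k * u $ j) * br x (axis j 1) $ l)"
      by (simp only: ax)
    also have "\<dots> = (wedge (br x u) v + wedge u (br x v)) $ (k, l)"
      by (simp add: br[of u] br[of v] sum_distrib_left sum_distrib_right
            sum_subtractf[symmetric] sum.distrib[symmetric] algebra_simps)
    finally show ?thesis .
  qed
  then show ?thesis by (simp add: vec_eq_iff)
qed

lemma weight_cobracket_axis:
  "weight_cobracket w (axis i 1) = (\<Sum>j\<in>UNIV. w i j *s wedge (axis i 1) (axis j 1))"
proof -
  have "weight_cobracket w (axis i 1) = (\<Sum>k\<in>UNIV. if k = i
      then \<Sum>j\<in>UNIV. w k j *s wedge (axis k 1) (axis j 1) else 0)"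
    unfolding weight_cobracket_def by (intro sum.cong refl) (auto simp: axis_def)
  then show ?thesis by simp
qed

end

theory Submission
  imports Defs
begin

text \<open>
  In coordinates \<open>\<delta>(f)\<^sub>k\<^sub>l = w\<^sub>k\<^sub>l (f\<^sub>k - f\<^sub>l)\<close>, so the bracket on the dual module is again the
  bracket of \<open>w\<close> and co-Jacobi is the Jacobi identity. The matching condition says that
  \<open>w\<^sub>i\<^sub>j w\<^sub>i\<^sub>k = 0\<close> for \<open>j \<noteq> k\<close>; then the Jacobi and cocycle identities decouple into polynomial
  identities, one for each edge. Conversely, the \<open>(a, k)\<close> component of the cocycle identity at
  \<open>(e\<^sub>a, e\<^sub>b)\<close> reads \<open>w\<^sub>b\<^sub>k (w\<^sub>a\<^sub>b + w\<^sub>a\<^sub>k) = 0\<close>, and permuting \<open>a, b, k\<close> yields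
  \<open>2 w\<^sub>a\<^sub>b w\<^sub>a\<^sub>k = 0\<close>.
\<close>

section \<open>Matchings and orthogonality of weights\<close>

definition orthogonal_weights :: "('v \<Rightarrow> 'v \<Rightarrow> 'r::comm_ring_1) \<Rightarrow> bool" where
  "orthogonal_weights w \<longleftrightarrow> (\<forall>i j k. j \<noteq> k \<longrightarrow> w i j * w i k = 0)"

text \<open>The product on \<open>complex ^ 'q\<close> is componentwise and \<open>complex\<close>
  has no zero divisors, so \<open>w i j * w i k\<close> is nonzero exactly when some channel
  contains both edges at \<open>i\<close>. A single ring equation thus controls all channels at
  once.\<close>

lemma matching_iff_orthogonal_weights:
  fixes w :: "'v \<Rightarrow> 'v \<Rightarrow> complex ^ 'q::finite"
  assumes "\<And>i j. w i j = w j i"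
  shows "(\<forall>\<alpha>. is_matching (channel_support w \<alpha>)) \<longleftrightarrow> orthogonal_weights w"
proof
  assume m: "\<forall>\<alpha>. is_matching (channel_support w \<alpha>)"
  show "orthogonal_weights w"
    unfolding orthogonal_weights_def vec_eq_iff
  proof (intro allI impI, rule ccontr)
    fix i j k \<alpha>
    assume "j \<noteq> k" "(w i j * w i k) $ \<alpha> \<noteq> 0 $ \<alpha>"
    then have "{i, j} \<in> channel_support w \<alpha>" "{i, k} \<in> channel_support w \<alpha>"
      unfolding channel_support_def by auto
    then have "{i, j} = {i, k}"
      using m unfolding is_matching_def Uniq_def by blast
    with \<open>j \<noteq> k\<close> show False by (simp add: doubleton_eq_iff)
  qed
next
  assume o: "orthogonal_weights w"
  \<comment> \<open>By symmetry, an edge through \<open>v\<close> can be written with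
    \<open>v\<close> as the first index of its weight.\<close>
  have inc: "\<exists>j. e = {v, j} \<and> w v j $ \<alpha> \<noteq> 0" if "e \<in> channel_support w \<alpha>" "v \<in> e" for e v \<alpha>
    using that assms unfolding channel_support_def by (auto simp: insert_commute)
  show "\<forall>\<alpha>. is_matching (channel_support w \<alpha>)"
    unfolding is_matching_def Uniq_def
  proof (intro allI impI, elim conjE)
    fix \<alpha> v e e'
    assume "e \<in> channel_support w \<alpha>" "v \<in> e" "e' \<in> channel_support w \<alpha>" "v \<in> e'"
    then obtain j k where jk: "e = {v, j}" "w v j $ \<alpha> \<noteq> 0" "e' = {v, k}" "w v k $ \<alpha> \<noteq> 0"
      using inc by metis
    then have "w v j * w v k \<noteq> 0" by (auto simp: vec_eq_iff)
    then have "j = k" using o unfolding orthogonal_weights_def by blast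
    with jk show "e = e'" by simp
  qed
qed

section \<open>Coordinate formulas for the bracket, the cobracket and the adjoint action\<close>

lemma sum_axis_mult:
  fixes c :: "'v::finite \<Rightarrow> 'r::comm_ring_1"
  shows "(\<Sum>i\<in>UNIV. c i * axis i 1 $ k) = c k" "(\<Sum>i\<in>UNIV. c i * axis k 1 $ i) = c k"
    "(\<Sum>i\<in>UNIV. axis k 1 $ i * c i) = c k"
  by (simp_all add: axis_def if_distrib[of "\<lambda>x. _ * x"] if_distrib[of "\<lambda>x. x * _"] cong: if_cong)

lemma weight_bracket_component:
  "weight_bracket w f g $ i = (\<Sum>j\<in>UNIV. w i j * (f $ i * g $ j - f $ j * g $ i))"
  by (simp add: weight_bracket_def)

lemma weight_bracket_axis_left:
  "weight_bracket w (axis a 1) g $ i = axis a 1 $ i * (\<Sum>j\<in>UNIV. w i j * g $ j) - w i a * g $ i"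
proof -
  have "weight_bracket w (axis a 1) g $ i =
      axis a 1 $ i * (\<Sum>j\<in>UNIV. w i j * g $ j) - (\<Sum>j\<in>UNIV. w i j * g $ i * axis a 1 $ j)"
    unfolding weight_bracket_component
    by (simp add: sum_subtractf sum_distrib_left algebra_simps)
  then show ?thesis by (simp only: sum_axis_mult)
qed

lemma weight_bracket_skew: "weight_bracket w f g = - weight_bracket w g f"
  by (simp add: vec_eq_iff weight_bracket_component sum_negf[symmetric] algebra_simps)

lemma weight_cobracket_component:
  assumes "\<And>i j. w i j = w j i"
  shows "weight_cobracket w f $ (k, l) = w k l * (f $ k - f $ l)"
proof -
  have "weight_cobracket w f $ (k, l)
      = (\<Sum>i\<in>UNIV. (\<Sum>j\<in>UNIV. f $ i * w i j * axis i 1 $ k * axis j 1 $ l))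
      - (\<Sum>i\<in>UNIV. (\<Sum>j\<in>UNIV. f $ i * w i j * axis i 1 $ l * axis j 1 $ k))"
    unfolding weight_cobracket_def
    by (simp add: sum_subtractf[symmetric] sum_distrib_left algebra_simps)
  also have "\<dots> = f $ k * w k l - f $ l * w l k"
    by (simp only: sum_axis_mult)
  finally show ?thesis using assms[of k l] by (simp add: algebra_simps)
qed

text \<open>With a tensor read as a matrix, the first summand of \<open>ad2\<close> acts on its
  columns and the second on its rows.\<close>

lemma ad2_weight_bracket_component:
  "ad2 (weight_bracket w) x M $ (k, l) =
     weight_bracket w x (\<chi> i. M $ (i, l)) $ k + weight_bracket w x (\<chi> j. M $ (k, j)) $ l"
proof -
  have lin: "weight_bracket w x g $ k = (\<Sum>i\<in>UNIV. g $ i * weight_bracket w x (axis i 1) $ k)"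
    for g k
  proof -
    have "(\<Sum>i\<in>UNIV. g $ i * weight_bracket w x (axis i 1) $ k)
        = (\<Sum>i\<in>UNIV. w k i * g $ i * x $ k) - (\<Sum>i\<in>UNIV. (g $ i * (\<Sum>j\<in>UNIV. w k j * x $ j)) * axis i 1 $ k)"
      by (subst weight_bracket_skew)
        (simp add: weight_bracket_axis_left sum_subtractf[symmetric] algebra_simps)
    also have "\<dots> = weight_bracket w x g $ k"
      unfolding sum_axis_mult weight_bracket_component
      by (simp add: sum_subtractf[symmetric] sum_distrib_left algebra_simps)
    finally show ?thesis ..
  qed
  \<comment> \<open>The sums of the second summand are exchanged so that in each half the inner sum
    runs against a Kronecker delta.\<close>
  have "ad2 (weight_bracket w) x M $ (k, l)
      = (\<Sum>i\<in>UNIV. \<Sum>j\<in>UNIV. (M $ (i, j) * weight_bracket w x (axis i 1) $ k) * axis j 1 $ l)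
      + (\<Sum>j\<in>UNIV. \<Sum>i\<in>UNIV. (M $ (i, j) * weight_bracket w x (axis j 1) $ l) * axis i 1 $ k)"
    unfolding ad2_def
    by (subst (3) sum.swap) (simp add: sum.distrib[symmetric] algebra_simps)
  then show ?thesis
    by (simp only: sum_axis_mult lin[of "\<chi> i. M $ (i, l)"] lin[of "\<chi> j. M $ (k, j)"] vec_lambda_beta)
qed

lemma module_hom_weight_bracket: "module_hom (*s) (*s) (weight_bracket w x)"
  by (intro module_hom.intro module_vec module_hom_axioms.intro)
    (simp_all add: vec_eq_iff weight_bracket_component sum.distrib[symmetric] sum_distrib_left
      algebra_simps)

lemma module_hom_weight_cobracket:
  assumes "\<And>i j. w i j = w j i"
  shows "module_hom (*s) (*s) (weight_cobracket w)"
  by (intro module_hom.intro module_vec module_hom_axioms.intro)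
    (simp_all add: vec_eq_iff weight_cobracket_component[OF assms] algebra_simps)

section \<open>From orthogonal weights to the Jacobi identity\<close>

text \<open>The decoupling mechanism: the factor \<open>w i j\<close> annihilates every term of the
  bracket at \<open>i\<close> except the one of the edge to \<open>j\<close>.\<close>

lemma weight_bracket_edge:
  assumes "orthogonal_weights w"
  shows "w i j * weight_bracket w f g $ i = w i j * w i j * (f $ i * g $ j - f $ j * g $ i)"
proof -
  have "w i j * weight_bracket w f g $ i
      = (\<Sum>k\<in>UNIV. w i j * w i k * (f $ i * g $ k - f $ k * g $ i))"
    by (simp add: weight_bracket_component sum_distrib_left mult.assoc)
  also have "\<dots> = (\<Sum>k\<in>UNIV. if k = j then w i j * w i k * (f $ i * g $ k - f $ k * g $ i) else 0)"
    using assms by (intro sum.cong) (auto simp: orthogonal_weights_def)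
  finally show ?thesis by simp
qed

lemma weight_bracket_jacobi:
  fixes w :: "'v::finite \<Rightarrow> 'v \<Rightarrow> 'r::comm_ring_1"
  assumes sym: "\<And>i j. w i j = w j i" and orth: "orthogonal_weights w"
  shows "weight_bracket w x (weight_bracket w y z) + weight_bracket w y (weight_bracket w z x)
    + weight_bracket w z (weight_bracket w x y) = 0"
proof -
  have double: "weight_bracket w x (weight_bracket w y z) $ i
      = (\<Sum>j\<in>UNIV. w i j * w i j * ((x $ i + x $ j) * (y $ j * z $ i - y $ i * z $ j)))" for x y z i
  proof -
    have "w i j * (x $ i * weight_bracket w y z $ j - x $ j * weight_bracket w y z $ i)
        = w i j * w i j * ((x $ i + x $ j) * (y $ j * z $ i - y $ i * z $ j))" for j
    proof -
      \<comment> \<open>Reading \<open>w i j\<close> as \<open>w j i\<close> in the first term lets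
        \<open>weight_bracket_edge\<close> apply at both endpoints.\<close>
      have "w i j * (x $ i * weight_bracket w y z $ j - x $ j * weight_bracket w y z $ i)
          = x $ i * (w j i * weight_bracket w y z $ j) - x $ j * (w i j * weight_bracket w y z $ i)"
        using sym[of j i] by (simp add: algebra_simps)
      then show ?thesis
        unfolding weight_bracket_edge[OF orth] unfolding sym[of j i] by (simp add: algebra_simps)
    qed
    then show ?thesis by (simp only: weight_bracket_component[of w x])
  qed
  show ?thesis
    \<comment> \<open>The cyclic sum vanishes for each \<open>j\<close> separately: up to sign and
      the factor \<open>w i j * w i j\<close>, it is a 3 by 3 determinant whose columns are the
      \<open>i\<close>-th coordinates of \<open>x\<close>, \<open>y\<close>, \<open>z\<close>, their
      \<open>j\<close>-th coordinates, and the sum of these two columns.\<close>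
    by (simp add: vec_eq_iff double sum.distrib[symmetric] distrib_left[symmetric])
      (simp add: algebra_simps)
qed

section \<open>Co-Jacobi by self-duality\<close>

lemma dual_bracket_weight_cobracket:
  assumes "\<And>i j. w i j = w j i"
  shows "dual_bracket (weight_cobracket w) \<xi> \<eta> x =
    (\<Sum>i\<in>UNIV. x $ i * weight_bracket w (\<chi> i. \<xi> (axis i 1)) (\<chi> i. \<eta> (axis i 1)) $ i)"
proof -
  have "dual_bracket (weight_cobracket w) \<xi> \<eta> x
      = (\<Sum>i\<in>UNIV. \<Sum>j\<in>UNIV. w i j * x $ i * \<xi> (axis i 1) * \<eta> (axis j 1))
      - (\<Sum>i\<in>UNIV. \<Sum>j\<in>UNIV. w i j * x $ j * \<xi> (axis i 1) * \<eta> (axis j 1))"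
    unfolding dual_bracket_def wedge_pairing_def weight_cobracket_component[OF assms]
    by (simp add: sum_subtractf[symmetric] algebra_simps)
  \<comment> \<open>Renaming the indices, with \<open>w\<close> symmetric, collects the coefficient
    of each \<open>x $ i\<close>.\<close>
  also have "(\<Sum>i\<in>UNIV. \<Sum>j\<in>UNIV. w i j * x $ j * \<xi> (axis i 1) * \<eta> (axis j 1))
      = (\<Sum>i\<in>UNIV. \<Sum>j\<in>UNIV. w i j * x $ i * \<xi> (axis j 1) * \<eta> (axis i 1))"
    by (subst sum.swap) (simp add: assms)
  finally show ?thesis
    by (simp add: weight_bracket_component sum_subtractf[symmetric] sum_distrib_left algebra_simps)
qed

text \<open>Identifying a functional with its values on the basis turns nested dual brackets into
  nested weight brackets.\<close>

lemma dual_bracket_weight_cobracket_axis: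
  assumes "\<And>i j. w i j = w j i"
  shows "(\<chi> i. dual_bracket (weight_cobracket w) \<xi> \<eta> (axis i 1)) =
    weight_bracket w (\<chi> i. \<xi> (axis i 1)) (\<chi> i. \<eta> (axis i 1))"
  unfolding vec_eq_iff dual_bracket_weight_cobracket[OF assms]
  by (simp only: vec_lambda_beta sum_axis_mult simp_thms)

lemma lie_cobracket_weight_cobracket:
  assumes sym: "\<And>i j. w i j = w j i" and diag: "\<And>i. w i i = 0"
    and orth: "orthogonal_weights w"
  shows "lie_cobracket (weight_cobracket w)"
  unfolding lie_cobracket_def
proof (intro conjI allI impI)
  show "range (weight_cobracket w) \<subseteq> exterior_square"
  proof clarify
    fix f
    show "weight_cobracket w f \<in> exterior_square"
      unfolding exterior_square_def mem_Collect_eq weight_cobracket_component[OF sym]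
    proof (intro conjI allI)
      show "w i j * (f $ i - f $ j) = - (w j i * (f $ j - f $ i))" for i j
        using sym[of i j] by (simp add: algebra_simps)
    qed (simp add: diag)
  qed
next
  fix \<xi> \<eta> \<zeta> x
  show "dual_bracket (weight_cobracket w) \<xi> (dual_bracket (weight_cobracket w) \<eta> \<zeta>) x
      + dual_bracket (weight_cobracket w) \<eta> (dual_bracket (weight_cobracket w) \<zeta> \<xi>) x
      + dual_bracket (weight_cobracket w) \<zeta> (dual_bracket (weight_cobracket w) \<xi> \<eta>) x = 0"
    \<comment> \<open>Once the three sums are merged, each \<open>x $ i\<close> multiplies the
      \<open>i\<close>-th component of a Jacobi sum of coordinate vectors.\<close>
    unfolding dual_bracket_weight_cobracket[OF sym, where x = x] dual_bracket_weight_cobracket_axis[OF sym]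
      sum.distrib[symmetric] distrib_left[symmetric] vector_add_component[symmetric]
      weight_bracket_jacobi[OF sym orth]
    by simp
qed (rule module_hom_weight_cobracket[OF sym])

section \<open>The cocycle identity for orthogonal weights\<close>

lemma weight_cobracket_cocycle:
  fixes w :: "'v::finite \<Rightarrow> 'v \<Rightarrow> 'r::comm_ring_1"
  assumes sym: "\<And>i j. w i j = w j i" and diag: "\<And>i. w i i = 0"
    and orth: "orthogonal_weights w"
  shows "weight_cobracket w (weight_bracket w x y) =
    ad2 (weight_bracket w) x (weight_cobracket w y) - ad2 (weight_bracket w) y (weight_cobracket w x)"
proof -
  \<comment> \<open>The column half of \<open>ad2\<close>. Only \<open>i = l\<close> contributes:
    \<open>w k i * w i l\<close> vanishes since \<open>k\<close> and \<open>l\<close> are distinct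
    neighbours of \<open>i\<close>, and \<open>w k i * w k l\<close> vanishes unless
    \<open>i = l\<close>.\<close>
  have half: "weight_bracket w x (\<chi> i. w i l * (y $ i - y $ l)) $ k
      = - (w k l * w k l * x $ l * (y $ k - y $ l))" if "k \<noteq> l" for x y k l
  proof -
    have "w k i * (x $ k * (w i l * (y $ i - y $ l)) - x $ i * (w k l * (y $ k - y $ l)))
        = (if i = l then - (w k l * w k l * x $ l * (y $ k - y $ l)) else 0)" for i
    proof -
      have "w k i * w i l = 0"
        using that orth sym[of k i] unfolding orthogonal_weights_def by metis
      moreover have "i = l \<or> w k i * w k l = 0"
        using orth unfolding orthogonal_weights_def by metis
      moreover have "w k i * (x $ k * (w i l * (y $ i - y $ l)) - x $ i * (w k l * (y $ k - y $ l)))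
        = (w k i * w i l) * (x $ k * (y $ i - y $ l)) - (w k i * w k l) * x $ i * (y $ k - y $ l)"
        by (simp add: algebra_simps)
      ultimately show ?thesis by auto
    qed
    then show ?thesis by (simp add: weight_bracket_component)
  qed
  \<comment> \<open>By symmetry a row of the cobracket is minus a column, so \<open>half\<close>
    with \<open>k\<close> and \<open>l\<close> exchanged also handles the row half.\<close>
  have row: "(\<chi> j. w k j * (y $ k - y $ j)) = - (\<chi> j. w j k * (y $ j - y $ k))" for y k
    by (simp add: vec_eq_iff sym[of k] algebra_simps)
  have neg: "weight_bracket w x (- g) = - weight_bracket w x g" for x g
    using module_hom.neg[OF module_hom_weight_bracket] .
  have ad: "ad2 (weight_bracket w) x (weight_cobracket w y) $ (k, l)
      = (if k = l then 0 else - (w k l * w k l * (x $ k + x $ l) * (y $ k - y $ l)))" for x y k l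
    unfolding ad2_weight_bracket_component weight_cobracket_component[OF sym] row neg
    using half[of k l x y] half[of l k x y] sym[of l k]
    by (simp add: algebra_simps)
  have "weight_cobracket w (weight_bracket w x y) $ (k, l) =
    ad2 (weight_bracket w) x (weight_cobracket w y) $ (k, l)
    - ad2 (weight_bracket w) y (weight_cobracket w x) $ (k, l)" for k l
  proof (cases "k = l")
    case True
    then show ?thesis by (simp add: ad weight_cobracket_component[OF sym] diag)
  next
    case False
    have "weight_cobracket w (weight_bracket w x y) $ (k, l)
        = w k l * weight_bracket w x y $ k - w l k * weight_bracket w x y $ l"
      using sym[of l k] by (simp add: weight_cobracket_component[OF sym] algebra_simps)
    \<comment> \<open>Both sides equal
      \<open>2 * w k l * w k l * (x $ k * y $ l - x $ l * y $ k)\<close>.\<close>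
    with False show ?thesis
      unfolding weight_bracket_edge[OF orth] ad using sym[of l k] by (simp add: algebra_simps)
  qed
  then show ?thesis by (simp add: vec_eq_iff)
qed

lemma lie_bialgebra_of_orthogonal_weights:
  assumes sym: "\<And>i j. w i j = w j i" and diag: "\<And>i. w i i = 0"
    and orth: "orthogonal_weights w"
  shows "lie_bialgebra (weight_bracket w) (weight_cobracket w)"
proof -
  have "module_hom (*s) (*s) (\<lambda>x. weight_bracket w x y)" for y
    by (intro module_hom.intro module_vec module_hom_axioms.intro)
      (simp_all add: vec_eq_iff weight_bracket_component sum.distrib[symmetric] sum_distrib_left
        algebra_simps)
  then have "lie_bracket (weight_bracket w)"
    unfolding lie_bracket_def
    using module_hom_weight_bracket weight_bracket_skew weight_bracket_jacobi[OF sym orth] by blast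
  then show ?thesis
    unfolding lie_bialgebra_def
    using lie_cobracket_weight_cobracket[OF assms] weight_cobracket_cocycle[OF assms] by blast
qed

section \<open>From the cocycle identity back to orthogonality\<close>

text \<open>The factor 2 stays because a general commutative ring may have 2-torsion; it is removed
  only over \<open>complex ^ 'q\<close>.\<close>

lemma two_orthogonal_of_cocycle:
  fixes w :: "'v::finite \<Rightarrow> 'v \<Rightarrow> 'r::comm_ring_1"
  assumes sym: "\<And>i j. w i j = w j i" and diag: "\<And>i. w i i = 0"
    and cocycle: "\<And>x y. weight_cobracket w (weight_bracket w x y) =
      ad2 (weight_bracket w) x (weight_cobracket w y) - ad2 (weight_bracket w) y (weight_cobracket w x)"
    and "j \<noteq> k"
  shows "2 * (w i j * w i k) = 0"
proof (cases "i = j \<or> i = k")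
  case True
  then show ?thesis by (auto simp: diag)
next
  case False
  have triple: "w b k * (w a b + w a k) = 0" if "a \<noteq> b" "a \<noteq> k" "b \<noteq> k" for a b k
  proof -
    have ax: "axis p (1::'r) $ p = 1" "p \<noteq> q \<Longrightarrow> axis p (1::'r) $ q = 0" for p q :: 'v
      by (simp_all add: axis_def)
    \<comment> \<open>This is the one full sum left in the expansion: \<open>e_a\<close> acting on
      column \<open>k\<close> of the cobracket of \<open>e_b\<close>, at component
      \<open>a\<close>.\<close>
    have "(\<Sum>j\<in>UNIV. w a j * (w j k * axis b 1 $ j)) = w a b * w b k"
      using sum_axis_mult(2)[of "\<lambda>j. w a j * w j k" b] by (simp add: mult.assoc)
    moreover have "weight_cobracket w (weight_bracket w (axis a 1) (axis b 1)) $ (a, k) =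
      ad2 (weight_bracket w) (axis a 1) (weight_cobracket w (axis b 1)) $ (a, k)
      - ad2 (weight_bracket w) (axis b 1) (weight_cobracket w (axis a 1)) $ (a, k)"
      by (simp add: cocycle)
    ultimately have "w a k * w a b = w a b * w b k + w a b * w a k + w k b * w a k"
      using that unfolding ad2_weight_bracket_component weight_cobracket_component[OF sym]
        weight_bracket_axis_left
      by (simp add: ax that[symmetric] sum_axis_mult)
    \<comment> \<open>The term \<open>w a b * w a k\<close> stands on both sides and
      cancels.\<close>
    then show ?thesis using sym[of k b] by (simp add: algebra_simps)
  qed
  \<comment> \<open>The pairwise sums of the three products of two edges of the triangle
    \<open>i\<close>, \<open>j\<close>, \<open>k\<close> vanish; adding the two sums that contain
    \<open>w i j * w i k\<close> and subtracting the third isolates twice that product.\<close>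
  have "w i j * w j k + w i k * w j k = 0" "w i k * w i j + w i k * w j k = 0"
    "w i j * w i k + w i j * w j k = 0"
    using triple[of i j k] triple[of j i k] triple[of k i j] False \<open>j \<noteq> k\<close>
    by (auto simp: sym[of j i] sym[of k i] sym[of k j] algebra_simps)
  moreover have "2 * (w i j * w i k) = (w i k * w i j + w i k * w j k)
      + (w i j * w i k + w i j * w j k) - (w i j * w j k + w i k * w j k)"
    by (simp add: algebra_simps)
  ultimately show ?thesis by simp
qed

theorem corollary3p5:
  fixes w :: "'v::finite \<Rightarrow> 'v \<Rightarrow> complex ^ 'q::finite"
  assumes w_sym: "\<And>i j. w i j = w j i"
    and w_diag: "\<And>i. w i i = 0"
  shows "lie_bialgebra (weight_bracket w) (weight_cobracket w) \<longleftrightarrow>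
    (\<forall>\<alpha>. is_matching (channel_support w \<alpha>))"
proof -
  have "orthogonal_weights w" if "lie_bialgebra (weight_bracket w) (weight_cobracket w)"
    unfolding orthogonal_weights_def
  proof (intro allI impI)
    fix i j k :: 'v
    assume "j \<noteq> k"
    from that have "weight_cobracket w (weight_bracket w x y) =
        ad2 (weight_bracket w) x (weight_cobracket w y)
        - ad2 (weight_bracket w) y (weight_cobracket w x)" for x y
      unfolding lie_bialgebra_def by blast
    from two_orthogonal_of_cocycle[OF w_sym w_diag this \<open>j \<noteq> k\<close>]
    have "w i j * w i k + w i j * w i k = 0"
      by (simp only: mult_2)
    then show "w i j * w i k = 0"
      \<comment> \<open>In each component this is an equation over \<open>complex\<close>, where 2
        is invertible.\<close>
      by (simp add: vec_eq_iff)
  qed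
  moreover have "lie_bialgebra (weight_bracket w) (weight_cobracket w)" if "orthogonal_weights w"
    using w_sym w_diag that by (rule lie_bialgebra_of_orthogonal_weights)
  moreover have "(\<forall>\<alpha>. is_matching (channel_support w \<alpha>)) \<longleftrightarrow> orthogonal_weights w"
    using w_sym by (rule matching_iff_orthogonal_weights)
  ultimately show ?thesis by blast
qed

end
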